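(* Let $n\ge1$. The number $x(n)$ of permutations in the Bruhat interval $[1,w_\square]\subseteq S_{2n}$ is $$x(n)=\sum_{k=1}^{n+1}\big((k-1)!\,S(n+1,k)\big)^2,$$ and the number $\sigma(n)$ of permutations in $[1,w_\square]\cap C_n$ is $$\sigma(n)=\sum_{k=1}^{n+1}(k-1)!\,S(n+1,k),$$ where $S(n,k)$ denotes the Stirling number of the second kind.
   Context: In one-line notation $w_\square=(n+1)(n+2)\cdots(2n)\,1\,2\cdots n\in S_{2n}$; $1$ is the identity; intervals are with respect to (strong) Bruhat order on $S_{2n}$. $C_n$ is the set of permutations $v=a_1\cdots a_{2n}\in S_{2n}$ (one-line notation) with $a_i+a_{2n+1-i}=2n+1$ for all $1\le i\le 2n$. (The numbers $x(n)$ and $\sigma(n)$ are equivalently the numbers of irreducible strata in certain determinantal stratifications of the spaces of $n\times n$ matrices and symmetric $n\times n$ matrices.) *)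

theory Defs
  imports Complex_Main "HOL-Combinatorics.Combinatorics"
begin

text \<open>
  \<open>S\<^sub>m\<close> is the set of functions \<open>u :: nat \<Rightarrow> nat\<close> with \<open>u permutes {1..m}\<close>; the one-line
  notation of \<open>u\<close> is \<open>u 1, u 2, \<dots>, u m\<close>.
\<close>

definition inversions :: "nat \<Rightarrow> (nat \<Rightarrow> nat) \<Rightarrow> (nat \<times> nat) set" where
  "inversions m u = {(i, j). 1 \<le> i \<and> i < j \<and> j \<le> m \<and> u i > u j}"

text \<open>The Coxeter length on \<open>S\<^sub>m\<close> with respect to the adjacent transpositions.\<close>
definition perm_length :: "nat \<Rightarrow> (nat \<Rightarrow> nat) \<Rightarrow> nat" where
  "perm_length m u = card (inversions m u)"

text \<open>
  The reflections of \<open>S\<^sub>m\<close> are the transpositions; they form a conjugacy class, so multiplying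
  on the left instead of on the right gives the same relation.
\<close>
definition bruhat_step :: "nat \<Rightarrow> (nat \<Rightarrow> nat) \<Rightarrow> (nat \<Rightarrow> nat) \<Rightarrow> bool" where
  "bruhat_step m u v \<longleftrightarrow> u permutes {1..m} \<and>
     (\<exists>a b. 1 \<le> a \<and> a < b \<and> b \<le> m \<and> v = u \<circ> transpose a b) \<and>
     perm_length m u < perm_length m v"

definition bruhat_le :: "nat \<Rightarrow> (nat \<Rightarrow> nat) \<Rightarrow> (nat \<Rightarrow> nat) \<Rightarrow> bool" where
  "bruhat_le m u v \<longleftrightarrow> u permutes {1..m} \<and> v permutes {1..m} \<and> (bruhat_step m)\<^sup>*\<^sup>* u v"

definition bruhat_interval :: "nat \<Rightarrow> (nat \<Rightarrow> nat) \<Rightarrow> (nat \<Rightarrow> nat) \<Rightarrow> (nat \<Rightarrow> nat) set" where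
  "bruhat_interval m u w = {v. bruhat_le m u v \<and> bruhat_le m v w}"

definition w_square :: "nat \<Rightarrow> nat \<Rightarrow> nat" where
  "w_square n i =
     (if 1 \<le> i \<and> i \<le> n then n + i
      else if n < i \<and> i \<le> 2 * n then i - n
      else i)"

definition C_perms :: "nat \<Rightarrow> (nat \<Rightarrow> nat) set" where
  "C_perms n = {v. v permutes {1..2 * n} \<and>
                   (\<forall>i\<in>{1..2 * n}. v i + v (2 * n + 1 - i) = 2 * n + 1)}"

text \<open>The numbers \<open>x(n)\<close> and \<open>\<sigma>(n)\<close>; the intervals are finite, being sets of permutations of a
  finite set.\<close>
definition x_num :: "nat \<Rightarrow> nat" where
  "x_num n = card (bruhat_interval (2 * n) id (w_square n))"

definition sigma_num :: "nat \<Rightarrow> nat" where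
  "sigma_num n = card (bruhat_interval (2 * n) id (w_square n) \<inter> C_perms n)"

end

theory Submission
  imports Defs
begin

text \<open>
  Let \<open>w\<close> be the permutation \<open>w_square n\<close>. The interval \<open>[1, w]\<close> consists of the
  permutations \<open>v\<close> of \<open>{1..2n}\<close> with \<open>\<bar>v i - i\<bar> \<le> n\<close> for all \<open>i\<close>
  (\<open>bruhat_interval_w_square\<close>). The permutation \<open>w\<close> satisfies this band condition, and a step down
  in Bruhat order preserves it: the step exchanges the values at positions \<open>a < b\<close> with \<open>v a > v b\<close>,
  and \<open>b - n \<le> v b < v a \<le> a + n\<close> gives all four new bounds. Conversely, a
  permutation \<open>v \<noteq> w\<close> in the band can be moved up inside the band by a transposition that a
  pigeonhole argument provides (\<open>band_perms_step_up\<close>); as lengths are bounded, iterating this ends at \<open>w\<close>.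

  The graph of a permutation in the band is a full placement of non-attacking rooks on the board
  of allowed cells. Cut this board into four \<open>n \<times> n\<close> quadrants, according to whether the position
  and the value are at most \<open>n\<close>. The two diagonal quadrants are unrestricted, and the other two are
  triangles. A staircase with rows of length \<open>1, \<dots>, n\<close> admits \<open>S (n + 1, n + 1 - r)\<close> placements of
  \<open>r\<close> rooks (\<open>card_rooks_triangle\<close>), by the recurrence of the Stirling numbers. Placements of \<open>r\<close>
  and \<open>s\<close> rooks in the two triangles leave free an \<open>(n - r) \<times> (n - s)\<close> and an
  \<open>(n - s) \<times> (n - r)\<close> rectangle in the diagonal quadrants. These can be filled completely only if
  \<open>r = s\<close>, and then in \<open>((n - r)!)\<^sup>2\<close> ways. Summation over \<open>k = n + 1 - r\<close> gives \<open>x(n)\<close>.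

  An element of \<open>C\<^sub>n\<close> is determined by its first \<open>n\<close> values. If these lie in the band, the values
  above \<open>n\<close> form a placement of some \<open>r\<close> rooks in one triangle. The values up to \<open>n\<close>, reflected by
  \<open>y \<mapsto> n + 1 - y\<close>, form a full placement in the \<open>(n - r) \<times> (n - r)\<close> square of the remaining rows and
  columns (\<open>bij_betw_C_perms\<close>). There are \<open>(n - r)!\<close> of the latter, which gives \<open>\<sigma>(n)\<close>.
\<close>

section \<open>Placements of non-attacking rooks\<close>

text \<open>
  A placement of non-attacking rooks on the board \<open>D\<close> is a set of cells of \<open>D\<close> no two of which
  share a row (first component) or a column (second component).
\<close>
definition rooks :: "('a \<times> 'b) set \<Rightarrow> ('a \<times> 'b) set set" where
  "rooks D = {F. F \<subseteq> D \<and> inj_on fst F \<and> inj_on snd F}"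

text \<open>
  The cells of \<open>D\<close> that share neither a row nor a column with a rook of \<open>F\<close>.
\<close>
definition free_cells :: "('a \<times> 'b) set \<Rightarrow> ('a \<times> 'b) set \<Rightarrow> ('a \<times> 'b) set" where
  "free_cells F D = {p \<in> D. fst p \<notin> fst ` F \<and> snd p \<notin> snd ` F}"

text \<open>
  The placements of exactly \<open>r\<close> rooks.
\<close>
definition rooks_of_size :: "('a \<times> 'b) set \<Rightarrow> nat \<Rightarrow> ('a \<times> 'b) set set" where
  "rooks_of_size D r = {F \<in> rooks D. card F = r}"

lemma finite_rooks [simp]: "finite D \<Longrightarrow> finite (rooks D)"
  by (rule finite_subset[of _ "Pow D"]) (auto simp: rooks_def)

lemma finite_rooks_of_size [simp]: "finite D \<Longrightarrow> finite (rooks_of_size D r)"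
  by (simp add: rooks_of_size_def)

lemma rooks_finite: "finite D \<Longrightarrow> F \<in> rooks D \<Longrightarrow> finite F"
  by (auto simp: rooks_def intro: finite_subset)

lemma rooks_card_fst: "F \<in> rooks D \<Longrightarrow> card (fst ` F) = card F"
  and rooks_card_snd: "F \<in> rooks D \<Longrightarrow> card (snd ` F) = card F"
  by (auto simp: rooks_def card_image)

lemma finite_free_cells [simp]: "finite D \<Longrightarrow> finite (free_cells F D)"
  by (simp add: free_cells_def)

lemma free_cells_Un: "free_cells F (D1 \<union> D2) = free_cells F D1 \<union> free_cells F D2"
  by (auto simp: free_cells_def)

lemma free_cells_Times: "free_cells F (A \<times> B) = (A - fst ` F) \<times> (B - snd ` F)"
  unfolding free_cells_def by (rule set_eqI) (simp only: mem_Times_iff mem_Collect_eq Diff_iff conj_ac)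

text \<open>
  A placement on a union of two disjoint boards arises uniquely by placing rooks on the first board
  and then rooks on the cells of the second that are still free.
\<close>
lemma bij_betw_rooks_Un:
  assumes "D1 \<inter> D2 = {}"
  shows "bij_betw (\<lambda>(F, H). F \<union> H) (SIGMA F:rooks D1. rooks (free_cells F D2)) (rooks (D1 \<union> D2))"
proof (rule bij_betw_byWitness[where f' = "\<lambda>P. (P \<inter> D1, P \<inter> D2)"])
  show "\<forall>a\<in>SIGMA F:rooks D1. rooks (free_cells F D2).
      (\<lambda>P. (P \<inter> D1, P \<inter> D2)) (case a of (F, H) \<Rightarrow> F \<union> H) = a"
    using assms by (auto simp: rooks_def free_cells_def)
  show "\<forall>a'\<in>rooks (D1 \<union> D2). (\<lambda>(F, H). F \<union> H) (a' \<inter> D1, a' \<inter> D2) = a'"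
    by (auto simp: rooks_def)
  show "(\<lambda>(F, H). F \<union> H) ` (SIGMA F:rooks D1. rooks (free_cells F D2)) \<subseteq> rooks (D1 \<union> D2)"
  proof clarify
    fix F H assume F: "F \<in> rooks D1" and H: "H \<in> rooks (free_cells F D2)"
    have "H \<subseteq> free_cells F D2" using H by (simp add: rooks_def)
    then have "fst ` F \<inter> fst ` H = {}" "snd ` F \<inter> snd ` H = {}"
      by (auto simp: free_cells_def subset_iff image_iff) force+
    then show "F \<union> H \<in> rooks (D1 \<union> D2)"
      using F H by (auto simp: rooks_def free_cells_def inj_on_Un)
  qed
  show "(\<lambda>P. (P \<inter> D1, P \<inter> D2)) ` rooks (D1 \<union> D2) \<subseteq> (SIGMA F:rooks D1. rooks (free_cells F D2))"
  proof (rule image_subsetI)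
    fix P assume P: "P \<in> rooks (D1 \<union> D2)"
    then have inj: "inj_on fst P" "inj_on snd P" by (auto simp: rooks_def)
    have "P \<inter> D2 \<subseteq> free_cells (P \<inter> D1) D2"
    proof
      fix p assume p: "p \<in> P \<inter> D2"
      have "fst p \<noteq> fst q \<and> snd p \<noteq> snd q" if "q \<in> P \<inter> D1" for q
        using inj_onD[OF inj(1), of p q] inj_onD[OF inj(2), of p q] that p assms by auto
      then show "p \<in> free_cells (P \<inter> D1) D2"
        using p by (auto simp: free_cells_def)
    qed
    then have "P \<inter> D1 \<in> rooks D1" "P \<inter> D2 \<in> rooks (free_cells (P \<inter> D1) D2)"
      using inj by (auto simp: rooks_def intro: inj_on_subset)
    then show "(P \<inter> D1, P \<inter> D2) \<in> (SIGMA F:rooks D1. rooks (free_cells F D2))"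
      by blast
  qed
qed

lemma sum_rooks_Un:
  assumes "finite D1" "finite D2" "D1 \<inter> D2 = {}"
  shows "(\<Sum>P\<in>rooks (D1 \<union> D2). w P)
    = (\<Sum>F\<in>rooks D1. \<Sum>H\<in>rooks (free_cells F D2). w (F \<union> H))"
  using assms by (simp add: sum.reindex_bij_betw[OF bij_betw_rooks_Un, symmetric] sum.Sigma case_prod_beta)

lemma card_rooks_of_size_Un:
  assumes "finite D1" "finite D2" "D1 \<inter> D2 = {}"
  shows "card (rooks_of_size (D1 \<union> D2) r)
    = (\<Sum>F\<in>rooks D1. card {H \<in> rooks (free_cells F D2). card F + card H = r})"
proof -
  have "card (rooks_of_size (D1 \<union> D2) r) = (\<Sum>P\<in>rooks (D1 \<union> D2). if card P = r then 1 else 0)"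
    using assms by (simp add: rooks_of_size_def sum.If_cases Int_def)
  also have "\<dots> = (\<Sum>F\<in>rooks D1. \<Sum>H\<in>rooks (free_cells F D2). if card (F \<union> H) = r then 1 else 0)"
    by (rule sum_rooks_Un[OF assms])
  also have "\<dots> = (\<Sum>F\<in>rooks D1. card {H \<in> rooks (free_cells F D2). card F + card H = r})"
  proof (rule sum.cong[OF refl])
    fix F assume F: "F \<in> rooks D1"
    have "card (F \<union> H) = card F + card H" if H: "H \<in> rooks (free_cells F D2)" for H
    proof (rule card_Un_disjoint)
      show "finite F" using F assms(1) by (auto dest: rooks_finite)
      show "finite H" using rooks_finite[OF finite_free_cells[OF assms(2)] H] .
      show "F \<inter> H = {}" using F H assms(3) by (auto simp: rooks_def free_cells_def)
    qed
    then have "(\<Sum>H\<in>rooks (free_cells F D2). if card (F \<union> H) = r then 1 else 0)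
      = (\<Sum>H\<in>rooks (free_cells F D2). if card F + card H = r then 1 else 0 :: nat)"
      by (intro sum.cong) auto
    also have "\<dots> = card {H \<in> rooks (free_cells F D2). card F + card H = r}"
      using assms by (simp add: sum.If_cases Int_def)
    finally show "(\<Sum>H\<in>rooks (free_cells F D2). if card (F \<union> H) = r then 1 else 0)
      = card {H \<in> rooks (free_cells F D2). card F + card H = r}" .
  qed
  finally show ?thesis .
qed

lemma sum_rooks_map_prod:
  assumes "inj_on f (fst ` D)" "inj_on g (snd ` D)"
  shows "(\<Sum>F\<in>rooks (map_prod f g ` D). w (card F)) = (\<Sum>F\<in>rooks D. w (card F))"
proof -
  have inj: "inj_on (map_prod f g) D"
    using assms by (auto simp: inj_on_def)
  have "bij_betw (\<lambda>F. map_prod f g ` F) (rooks D) (rooks (map_prod f g ` D))"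
  proof (rule bij_betw_imageI)
    show "inj_on ((`) (map_prod f g)) (rooks D)"
      by (rule inj_on_subset[OF inj_on_image_Pow[OF inj]]) (auto simp: rooks_def)
    have *: "map_prod f g ` F \<in> rooks (map_prod f g ` D) \<longleftrightarrow> F \<in> rooks D" if "F \<subseteq> D" for F
    proof -
      have i: "inj_on (map_prod f g) F" using inj that by (rule inj_on_subset)
      have "inj_on fst (map_prod f g ` F) \<longleftrightarrow> inj_on (f \<circ> fst) F"
        using comp_inj_on_iff[OF i, of fst] by (simp add: fst_comp_map_prod)
      moreover have "inj_on (f \<circ> fst) F \<longleftrightarrow> inj_on fst F"
        using that assms(1) by (meson comp_inj_on image_mono inj_on_imageI2 inj_on_subset)
      moreover have "inj_on snd (map_prod f g ` F) \<longleftrightarrow> inj_on (g \<circ> snd) F"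
        using comp_inj_on_iff[OF i, of snd] by (simp add: snd_comp_map_prod)
      moreover have "inj_on (g \<circ> snd) F \<longleftrightarrow> inj_on snd F"
        using that assms(2) by (meson comp_inj_on image_mono inj_on_imageI2 inj_on_subset)
      ultimately show ?thesis using that by (auto simp: rooks_def)
    qed
    show "(`) (map_prod f g) ` rooks D = rooks (map_prod f g ` D)"
    proof (intro equalityI subsetI)
      fix G assume "G \<in> (`) (map_prod f g) ` rooks D"
      then show "G \<in> rooks (map_prod f g ` D)" using * by (auto simp: rooks_def)
    next
      fix G assume G: "G \<in> rooks (map_prod f g ` D)"
      then obtain F where "F \<subseteq> D" "G = map_prod f g ` F"
        by (auto simp: rooks_def subset_image_iff)
      then show "G \<in> (`) (map_prod f g) ` rooks D" using * G by auto
    qed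
  qed
  then have "(\<Sum>F\<in>rooks (map_prod f g ` D). w (card F)) = (\<Sum>F\<in>rooks D. w (card (map_prod f g ` F)))"
    by (rule sum.reindex_bij_betw[symmetric])
  also have "\<dots> = (\<Sum>F\<in>rooks D. w (card F))"
    by (rule sum.cong) (auto simp: rooks_def card_image inj_on_subset[OF inj])
  finally show ?thesis .
qed

text \<open>
  Let \<open>B\<close> contain all columns of \<open>D\<close>, and add a full row over \<open>B\<close> to the board. The new row is either
  empty, or its rook takes one of the columns of \<open>B\<close> that the other \<open>r\<close> rooks leave free.
\<close>
lemma card_rooks_insert_row:
  assumes fin: "finite D" "finite B" and a: "a \<notin> fst ` D" and B: "snd ` D \<subseteq> B"
  shows "card (rooks_of_size (D \<union> {a} \<times> B) (Suc r))
    = card (rooks_of_size D (Suc r)) + (card B - r) * card (rooks_of_size D r)"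
proof -
  let ?S = "SIGMA F:rooks_of_size D r. B - snd ` F"
  let ?f = "\<lambda>(F, b). insert (a, b) F"
  have aF: "(a, b) \<notin> F" if "F \<in> rooks D" for F b
    using a that by (force simp: rooks_def)
  have 1: "rooks_of_size (D \<union> {a} \<times> B) (Suc r) = rooks_of_size D (Suc r) \<union> ?f ` ?S" (is "?L = ?R")
  proof (intro equalityI subsetI)
    fix P assume P: "P \<in> ?L"
    then have inj: "inj_on fst P" "inj_on snd P" "finite P" and sub: "P \<subseteq> D \<union> {a} \<times> B"
      using fin by (auto simp: rooks_def rooks_of_size_def intro: finite_subset)
    show "P \<in> ?R"
    proof (cases "P \<subseteq> D")
      case True then show ?thesis using P by (auto simp: rooks_def rooks_of_size_def)
    next
      case False
      then obtain b where b: "(a, b) \<in> P" "b \<in> B" using sub by auto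
      let ?F = "P - {(a, b)}"
      have "?F \<subseteq> D"
      proof
        fix p assume p: "p \<in> ?F"
        then have "fst p \<noteq> a" using inj_onD[OF inj(1), of p "(a,b)"] b by auto
        then show "p \<in> D" using p sub by auto
      qed
      moreover have "b \<notin> snd ` ?F" using inj_onD[OF inj(2), of "(a,b)"] b by auto
      ultimately have "(?F, b) \<in> ?S"
        using P b inj by (auto simp: rooks_def rooks_of_size_def intro: inj_on_subset)
      moreover have "P = ?f (?F, b)" using b by auto
      ultimately show ?thesis by blast
    qed
  next
    fix P assume "P \<in> ?R"
    then show "P \<in> ?L"
    proof
      assume "P \<in> rooks_of_size D (Suc r)"
      then show ?thesis by (auto simp: rooks_def rooks_of_size_def)
    next
      assume "P \<in> ?f ` ?S"
      then obtain F b where F: "F \<in> rooks D" "card F = r" "b \<in> B" "b \<notin> snd ` F" "P = insert (a, b) F"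
        by (auto simp: rooks_of_size_def)
      moreover have "a \<notin> fst ` F" using a F by (auto simp: rooks_def)
      moreover have "card P = Suc r" using F aF rooks_finite[OF fin(1)] by simp
      ultimately show ?thesis by (auto simp: rooks_of_size_def rooks_def inj_on_insert image_iff)
    qed
  qed
  have 2: "inj_on ?f ?S"
  proof (rule inj_onI, clarify)
    fix F b F' b' assume h: "F \<in> rooks_of_size D r" "F' \<in> rooks_of_size D r" "insert (a, b) F = insert (a, b') F'"
    then have n: "(a, x) \<notin> F" "(a, x) \<notin> F'" for x using aF by (auto simp: rooks_of_size_def)
    have "b = b'" using h(3) n by blast
    then show "F = F' \<and> b = b'" using h(3) n by (metis insert_ident)
  qed
  have 3: "rooks_of_size D (Suc r) \<inter> ?f ` ?S = {}"
    using aF by (fastforce simp: rooks_of_size_def)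
  have "card ?S = (\<Sum>F\<in>rooks_of_size D r. card (B - snd ` F))"
    using fin by simp
  also have "\<dots> = (\<Sum>F\<in>rooks_of_size D r. card B - r)"
  proof (rule sum.cong[OF refl])
    fix F assume F: "F \<in> rooks_of_size D r"
    then have "snd ` F \<subseteq> B" using B by (auto simp: rooks_of_size_def rooks_def)
    then have "card (B - snd ` F) = card B - card (snd ` F)"
      using fin by (intro card_Diff_subset) (auto intro: finite_subset)
    then show "card (B - snd ` F) = card B - r"
      using F by (auto simp: rooks_of_size_def rooks_card_snd)
  qed
  finally have "card ?S = (card B - r) * card (rooks_of_size D r)" by simp
  moreover have "card ?L = card (rooks_of_size D (Suc r)) + card ?S"
    unfolding 1 using fin 3 by (subst card_Un_disjoint) (auto simp: card_image[OF 2])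
  ultimately show ?thesis by simp
qed

lemma rooks_of_size_0 [simp]: "finite D \<Longrightarrow> rooks_of_size D 0 = {{}}"
  by (auto simp: rooks_of_size_def rooks_def dest: finite_subset)

lemma card_rooks_rectangle:
  assumes "finite A" "finite B"
  shows "card (rooks_of_size (A \<times> B) (card A)) = (\<Prod>i<card A. card B - i)"
  using assms(1)
proof induction
  case empty then show ?case by simp
next
  case (insert a A)
  have "rooks_of_size (A \<times> B) (Suc (card A)) = {}"
  proof -
    have False if "F \<in> rooks (A \<times> B)" "card F = Suc (card A)" for F
    proof -
      have "card (fst ` F) \<le> card A" using that insert by (intro card_mono) (auto simp: rooks_def)
      then show False using that rooks_card_fst[OF that(1)] by simp
    qed
    then show ?thesis by (auto simp: rooks_of_size_def)
  qed
  moreover have "insert a A \<times> B = A \<times> B \<union> {a} \<times> B" by auto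
  ultimately show ?case
    using insert assms(2) card_rooks_insert_row[of "A \<times> B" B a "card A"]
    by (auto simp: mult.commute)
qed

corollary card_rooks_square:
  assumes "finite A" "finite B" "card A = m" "card B = m"
  shows "card (rooks_of_size (A \<times> B) m) = fact m"
  using card_rooks_rectangle[OF assms(1,2)] assms
  by (simp add: fact_prod_rev lessThan_atLeast0)

lemma rooks_rectangle_card_le:
  assumes "finite A" "finite B" "F \<in> rooks (A \<times> B)"
  shows "card F \<le> card A" "card F \<le> card B"
proof -
  have "fst ` F \<subseteq> A" "snd ` F \<subseteq> B" using assms by (auto simp: rooks_def)
  then show "card F \<le> card A" "card F \<le> card B"
    using card_mono[OF assms(1), of "fst ` F"] card_mono[OF assms(2), of "snd ` F"]
      rooks_card_fst[OF assms(3)] rooks_card_snd[OF assms(3)] by auto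
qed

text \<open>
  Two blocks without a common row or column, of sizes \<open>p \<times> q\<close> and \<open>q \<times> p\<close>, each carry at most
  \<open>min p q\<close> rooks; so they carry \<open>p + q\<close> rooks together only if \<open>p = q\<close> and both are full.
\<close>
lemma card_rooks_two_blocks:
  assumes fin: "finite A" "finite B" "finite C" "finite E" and disj: "A \<inter> C = {}" "B \<inter> E = {}"
    and c: "card A = p" "card B = q" "card C = q" "card E = p"
  shows "card (rooks_of_size (A \<times> B \<union> C \<times> E) (p + q)) = (if p = q then (fact p)\<^sup>2 else 0)"
proof -
  have fr: "free_cells H (C \<times> E) = C \<times> E" if "H \<in> rooks (A \<times> B)" for H
  proof -
    have "fst ` H \<subseteq> A" "snd ` H \<subseteq> B" using that by (auto simp: rooks_def)
    then have "C - fst ` H = C" "E - snd ` H = E" using disj by blast+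
    then show ?thesis by (simp only: free_cells_Times)
  qed
  have H: "card H \<le> min p q" if "H \<in> rooks (A \<times> B)" for H
    using rooks_rectangle_card_le[OF fin(1,2) that] c by simp
  have K: "card K \<le> min p q" if "K \<in> rooks (C \<times> E)" for K
    using rooks_rectangle_card_le[OF fin(3,4) that] c by simp
  have "card (rooks_of_size (A \<times> B \<union> C \<times> E) (p + q))
    = (\<Sum>H\<in>rooks (A \<times> B). card {K \<in> rooks (C \<times> E). card H + card K = p + q})"
    using disj fin by (subst card_rooks_of_size_Un) (auto simp: fr intro!: sum.cong)
  also have "\<dots> = (\<Sum>H\<in>rooks (A \<times> B). if p = q \<and> card H = p then fact p else 0)"
  proof (rule sum.cong[OF refl])
    fix F assume F: "F \<in> rooks (A \<times> B)"
    show "card {K \<in> rooks (C \<times> E). card F + card K = p + q} = (if p = q \<and> card F = p then fact p else 0)"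
    proof (cases "p = q \<and> card F = p")
      case True
      then have "{K \<in> rooks (C \<times> E). card F + card K = p + q} = rooks_of_size (C \<times> E) p"
        by (auto simp: rooks_of_size_def)
      then show ?thesis using True card_rooks_square[OF fin(3,4)] c by simp
    next
      case False
      then have "{K \<in> rooks (C \<times> E). card F + card K = p + q} = {}"
        using H[OF F] K by force
      then show ?thesis using False by (metis card.empty)
    qed
  qed
  also have "\<dots> = (if p = q then (fact p)\<^sup>2 else 0)"
  proof (cases "p = q")
    case True
    then have "card {H \<in> rooks (A \<times> B). card H = p} = fact p"
      using card_rooks_square[OF fin(1,2)] c by (simp add: rooks_of_size_def)
    then show ?thesis using True fin by (simp add: sum.If_cases Int_def power2_eq_square)
  qed simp
  finally show ?thesis .
qed

section \<open>The triangular board and Stirling numbers\<close>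

text \<open>
  The staircase board with rows \<open>1, \<dots>, n\<close>, where row \<open>i\<close> has the columns \<open>1, \<dots>, i\<close>.
\<close>
definition triangle :: "nat \<Rightarrow> (nat \<times> nat) set" where
  "triangle n = {(i, j). 1 \<le> j \<and> j \<le> i \<and> i \<le> n}"

lemma finite_triangle [simp]: "finite (triangle n)"
  by (rule finite_subset[of _ "{..n} \<times> {..n}"]) (auto simp: triangle_def)

text \<open>
  The last row contains every column of the board, so \<open>card_rooks_insert_row\<close> applies to it and gives
  the recurrence of the Stirling numbers. For \<open>r > n\<close> there are no placements, and the right-hand side
  is \<open>0\<close> because \<open>n + 1 - r\<close> is the natural number \<open>0\<close>.
\<close>
lemma card_rooks_triangle:
  "card (rooks_of_size (triangle n) r) = Stirling (n + 1) (n + 1 - r)"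
proof (induction n arbitrary: r)
  case 0
  have e: "triangle 0 = {}" by (auto simp: triangle_def)
  have "rooks_of_size (triangle 0) r = (if r = 0 then {{}} else {})"
    unfolding e by (auto simp: rooks_of_size_def rooks_def)
  then show ?case by (cases r) auto
next
  case (Suc n)
  have e: "triangle (Suc n) = triangle n \<union> {Suc n} \<times> {1..Suc n}" by (auto simp: triangle_def)
  show ?case
  proof (cases r)
    case 0 then show ?thesis by (simp add: Stirling_same del: Stirling.simps)
  next
    case (Suc s)
    have "card (rooks_of_size (triangle (Suc n)) (Suc s))
      = card (rooks_of_size (triangle n) (Suc s)) + (card {1..Suc n} - s) * card (rooks_of_size (triangle n) s)"
      unfolding e by (rule card_rooks_insert_row) (simp_all, auto simp: triangle_def)
    also have "\<dots> = Stirling (n + 1) (n - s) + (Suc n - s) * Stirling (n + 1) (Suc n - s)"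
      by (simp add: Suc.IH del: Stirling.simps)
    also have "\<dots> = Stirling (n + 2) (Suc n - s)"
    proof (cases "s \<le> n")
      case True then show ?thesis by (simp add: Suc_diff_le)
    next
      case False then show ?thesis by simp
    qed
    finally show ?thesis using Suc by simp
  qed
qed

lemma rooks_triangle_card_le:
  assumes "F \<in> rooks (triangle n)"
  shows "card F \<le> n"
proof -
  have "F \<in> rooks ({1..n} \<times> {1..n})"
    using assms by (fastforce simp: rooks_def triangle_def)
  then show ?thesis using rooks_rectangle_card_le(1)[of "{1..n}" "{1..n}" F] by simp
qed

lemma sum_rooks_triangle:
  fixes g :: "nat \<Rightarrow> nat"
  shows "(\<Sum>F\<in>rooks (triangle n). g (card F)) = (\<Sum>k=1..n+1. Stirling (n + 1) k * g (n + 1 - k))"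
proof -
  have "(\<Sum>F\<in>rooks (triangle n). g (card F))
      = (\<Sum>r\<le>n. \<Sum>F\<in>{F \<in> rooks (triangle n). card F = r}. g (card F))"
    by (rule sum.group[symmetric]) (auto dest: rooks_triangle_card_le)
  also have "\<dots> = (\<Sum>r\<le>n. card (rooks_of_size (triangle n) r) * g r)"
    by (simp add: rooks_of_size_def)
  also have "\<dots> = (\<Sum>r\<le>n. Stirling (n + 1) (n + 1 - r) * g r)"
    by (simp only: card_rooks_triangle)
  also have "\<dots> = (\<Sum>k=1..n+1. Stirling (n + 1) k * g (n + 1 - k))"
    by (rule sum.reindex_bij_witness[of _ "\<lambda>k. n + 1 - k" "\<lambda>r. n + 1 - r"]) auto
  finally show ?thesis .
qed

section \<open>The Bruhat interval as a band of permutations\<close>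

text \<open>
  The permutations \<open>v\<close> of \<open>{1..2n}\<close> with \<open>\<bar>v i - i\<bar> \<le> n\<close> for all \<open>i\<close>; the condition is written
  without subtraction.
\<close>
definition band_perms :: "nat \<Rightarrow> (nat \<Rightarrow> nat) set" where
  "band_perms n = {v. v permutes {1..2 * n} \<and> (\<forall>i\<in>{1..2 * n}. v i \<le> i + n \<and> i \<le> v i + n)}"

lemma finite_inversions [simp]: "finite (inversions m u)"
  by (rule finite_subset[of _ "{1..m} \<times> {1..m}"]) (auto simp: inversions_def)

lemma perm_length_less_transpose:
  assumes ab: "1 \<le> a" "a < b" "b \<le> m" and u: "u a < u b"
  shows "perm_length m u < perm_length m (u \<circ> transpose a b)"
proof -
  let ?t = "transpose a b" and ?v = "u \<circ> transpose a b"
  \<comment> \<open>an injection from the inversions of \<open>u\<close> to those of \<open>?v\<close> that misses \<open>(a, b)\<close>\<close>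
  let ?f = "\<lambda>(i, j). if ?t i < ?t j then (?t i, ?t j) else (i, j)"
  have inj: "inj_on ?f (inversions m u)"
  proof (rule inj_onI, clarify)
    fix i j k l
    assume h: "(i, j) \<in> inversions m u" "(k, l) \<in> inversions m u"
      "(if ?t i < ?t j then (?t i, ?t j) else (i, j)) = (if ?t k < ?t l then (?t k, ?t l) else (k, l))"
    then have "i < j" "k < l" by (auto simp: inversions_def)
    then show "i = k \<and> j = l"
      using h(3) by (auto split: if_splits dest: transpose_eq_imp_eq)
  qed
  have sub: "?f ` inversions m u \<subseteq> inversions m ?v - {(a, b)}"
  proof (rule image_subsetI)
    fix p assume "p \<in> inversions m u"
    then obtain i j where p: "p = (i, j)" and ij: "1 \<le> i" "i < j" "j \<le> m" "u j < u i"
      by (auto simp: inversions_def)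
    show "?f p \<in> inversions m ?v - {(a, b)}"
      using ij ab u unfolding p inversions_def transpose_def
      by (auto split: if_splits)
  qed
  have ab_in: "(a, b) \<in> inversions m ?v" using ab u by (auto simp: inversions_def)
  have "card (inversions m u) = card (?f ` inversions m u)" using inj by (simp add: card_image)
  also have "\<dots> \<le> card (inversions m ?v - {(a, b)})" using sub by (intro card_mono) auto
  also have "\<dots> < card (inversions m ?v)" using ab_in by (intro card_Diff1_less) auto
  finally show ?thesis by (simp add: perm_length_def)
qed

lemma perm_length_transpose_less_iff:
  assumes "1 \<le> a" "a < b" "b \<le> m" "inj u"
  shows "perm_length m u < perm_length m (u \<circ> transpose a b) \<longleftrightarrow> u a < u b"
proof
  assume l: "perm_length m u < perm_length m (u \<circ> transpose a b)"
  show "u a < u b"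
  proof (rule ccontr)
    assume "\<not> u a < u b"
    then have "u b < u a" using assms(2,4) by (metis injD linorder_neqE_nat less_irrefl)
    then have "perm_length m (u \<circ> transpose a b) < perm_length m ((u \<circ> transpose a b) \<circ> transpose a b)"
      using assms by (intro perm_length_less_transpose) auto
    then show False using l by (simp add: comp_assoc)
  qed
qed (rule perm_length_less_transpose[OF assms(1-3)])

text \<open>
  Length increases along a transposition exactly if it creates an inversion at its two positions,
  so no lengths need to be compared in a Bruhat step.
\<close>
lemma bruhat_step_iff:
  "bruhat_step m u v \<longleftrightarrow> u permutes {1..m} \<and>
     (\<exists>a b. 1 \<le> a \<and> a < b \<and> b \<le> m \<and> u a < u b \<and> v = u \<circ> transpose a b)"
proof (cases "u permutes {1..m}")
  case True
  then have "inj u" by (rule permutes_inj)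
  then show ?thesis
    using perm_length_transpose_less_iff[of _ _ m u] unfolding bruhat_step_def by auto
qed (simp add: bruhat_step_def)

lemma permutes_comp_transpose:
  fixes u :: "nat \<Rightarrow> nat"
  assumes "u permutes {1..m}" "1 \<le> a" "a < b" "b \<le> m"
  shows "u \<circ> transpose a b permutes {1..m}"
proof -
  have "a \<in> {1..m}" "b \<in> {1..m}" using assms by auto
  then show ?thesis using assms(1) by (intro permutes_compose permutes_swap_id)
qed

lemma perm_length_le: "perm_length m u \<le> m * m"
proof -
  have "inversions m u \<subseteq> {1..m} \<times> {1..m}" by (auto simp: inversions_def)
  then have "card (inversions m u) \<le> card ({1..m} \<times> {1..m})" by (intro card_mono) auto
  then show ?thesis by (simp add: perm_length_def)
qed

text \<open>
  A permutation other than the identity has an inversion at its first non-fixed position, so there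
  is a step down from it.
\<close>
lemma bruhat_le_id:
  assumes "v permutes {1..m}"
  shows "bruhat_le m id v"
proof -
  have "(bruhat_step m)\<^sup>*\<^sup>* id v"
    using assms
  proof (induction "perm_length m v" arbitrary: v rule: less_induct)
    case less
    show ?case
    proof (cases "v = id")
      case False
      define a where "a = (LEAST i. v i \<noteq> i)"
      have "\<exists>i. v i \<noteq> i" using False by auto
      then have a: "v a \<noteq> a" unfolding a_def by (rule LeastI_ex)
      have fixed: "v i = i" if "i < a" for i using not_less_Least[of i "\<lambda>i. v i \<noteq> i"] that a_def by auto
      have inj: "inj v" using less.prems by (rule permutes_inj)
      obtain b where b: "v b = a" using permutes_surj[OF less.prems] by (metis surjD)
      have "a \<in> {1..m}" using a less.prems by (meson permutes_not_in)
      moreover have "b \<noteq> a" using a b by auto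
      moreover then have "\<not> b < a" using fixed[of b] b by auto
      moreover have "b \<in> {1..m}" using b \<open>b \<noteq> a\<close> less.prems by (metis permutes_not_in)
      moreover have "v a > a" using a fixed[of "v a"] injD[OF inj, of "v a" a] by (metis linorder_neqE_nat)
      ultimately have ab: "1 \<le> a" "a < b" "b \<le> m" "v b < v a" using b by auto
      let ?u = "v \<circ> transpose a b"
      have u: "?u permutes {1..m}" using less.prems ab by (intro permutes_comp_transpose) auto
      have "perm_length m ?u < perm_length m (?u \<circ> transpose a b)"
        using ab by (intro perm_length_less_transpose) auto
      then have "perm_length m ?u < perm_length m v" by (simp add: comp_assoc)
      then have "(bruhat_step m)\<^sup>*\<^sup>* id ?u" using less.hyps u by blast
      moreover have "bruhat_step m ?u v"
        unfolding bruhat_step_iff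
      proof (intro conjI exI)
        show "v = ?u \<circ> transpose a b" by (simp add: comp_assoc)
      qed (use ab u in auto)
      ultimately show ?thesis by auto
    qed simp
  qed
  then show ?thesis using assms by (simp add: bruhat_le_def permutes_id)
qed

lemma w_square_permutes: "w_square n permutes {1..2 * n}"
proof (rule bij_imp_permutes)
  show "bij_betw (w_square n) {1..2 * n} {1..2 * n}"
    by (rule bij_betw_byWitness[where f' = "w_square n"]) (auto simp: w_square_def)
qed (auto simp: w_square_def)

lemma w_square_band: "w_square n \<in> band_perms n"
  using w_square_permutes by (auto simp: band_perms_def w_square_def)

lemma band_perms_down_closed:
  assumes "v \<in> band_perms n" "bruhat_step (2 * n) u v"
  shows "u \<in> band_perms n"
proof -
  obtain a b where ab: "1 \<le> a" "a < b" "b \<le> 2 * n" "u a < u b" "v = u \<circ> transpose a b"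
    and u: "u permutes {1..2 * n}"
    using assms(2) unfolding bruhat_step_iff by blast
  have v: "v i \<le> i + n \<and> i \<le> v i + n" if "i \<in> {1..2 * n}" for i
    using assms(1) that by (auto simp: band_perms_def)
  have "v a = u b" "v b = u a" using ab by auto
  have "u i \<le> i + n \<and> i \<le> u i + n" if i: "i \<in> {1..2 * n}" for i
  proof -
    consider "i = a" | "i = b" | "i \<noteq> a" "i \<noteq> b" by blast
    then show ?thesis
    proof cases
      case 3
      then have "v i = u i" using ab by (simp add: transpose_def)
      then show ?thesis using v[OF i] by simp
    qed (use v[of a] v[of b] ab \<open>v a = u b\<close> \<open>v b = u a\<close> in auto)
  qed
  then show ?thesis using u by (auto simp: band_perms_def)
qed

text \<open>
  In the band, the first \<open>n\<close> values of \<open>w_square n\<close> force the other values: only \<open>1, \<dots>, n\<close> are left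
  for the positions \<open>2n, 2n - 1, \<dots>, n + 1\<close>, whose values are at least \<open>n, n - 1, \<dots>, 1\<close>.
\<close>
lemma band_perms_eq_w_square:
  assumes v: "v \<in> band_perms n" and left: "\<And>i. 1 \<le> i \<Longrightarrow> i \<le> n \<Longrightarrow> v i = n + i"
  shows "v = w_square n"
proof -
  have p: "v permutes {1..2 * n}" and inj: "inj v" 
    and bnd: "\<And>i. i \<in> {1..2 * n} \<Longrightarrow> i \<le> v i + n"
    using v permutes_inj by (auto simp: band_perms_def)
  have right: "v (n + (n - k)) = n - k" if "k < n" for k
    using that
  proof (induction k rule: less_induct)
    case (less k)
    let ?i = "n + (n - k)"
    have i: "?i \<in> {1..2 * n}" "n < ?i" using less.prems by auto
    have r: "v ?i \<in> {1..2 * n}" using i by (simp only: permutes_in_image[OF p])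
    have "v ?i \<le> n"
    proof (rule ccontr)
      assume "\<not> v ?i \<le> n"
      then have "v (v ?i - n) = v ?i" using left[of "v ?i - n"] r by auto
      then have "v ?i - n = ?i" using inj by (simp add: inj_eq)
      then show False using r i by auto
    qed
    moreover have "n - k \<le> v ?i" using bnd[OF i(1)] by simp
    moreover have "\<not> n - k < v ?i"
    proof
      assume gt: "n - k < v ?i"
      define l where "l = n - v ?i"
      have "l < k" "n - l = v ?i" using gt calculation less.prems by (auto simp: l_def)
      then have "v (n + (n - l)) = v ?i" using less.IH[of l] less.prems by simp
      then have "n + (n - l) = ?i" using inj by (simp add: inj_eq)
      then show False using \<open>l < k\<close> less.prems by auto
    qed
    ultimately show ?case by simp
  qed
  show ?thesis
  proof
    fix i
    consider "1 \<le> i \<and> i \<le> n" | "n < i" "i \<le> 2 * n" | "i \<notin> {1..2 * n}" by fastforce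
    then show "v i = w_square n i"
    proof cases
      case 1 then show ?thesis using left by (simp add: w_square_def)
    next
      case 2 then show ?thesis using right[of "2 * n - i"] by (simp add: w_square_def)
    next
      case 3 then show ?thesis using permutes_not_in[OF p 3] by (auto simp: w_square_def)
    qed
  qed
qed

text \<open>
  Let \<open>a\<close> be the first position with \<open>v a \<noteq> n + a\<close>. Exchanging the values at \<open>a\<close> and some \<open>b > a\<close>
  with \<open>v a < v b\<close> stays in the band provided that \<open>v b \<le> n + a\<close> and \<open>b \<le> n + v a\<close>. If \<open>v a > n\<close>, the
  position of the value \<open>n + a\<close> is such a \<open>b\<close>. If \<open>v a \<le> n\<close> and there were no such \<open>b\<close>, then the
  \<open>n + v a - a\<close> positions after \<open>a\<close> and up to \<open>n + v a\<close> would have to use values below \<open>v a\<close> or above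
  \<open>n + a\<close>, of which there are only \<open>(v a - 1) + (n - a)\<close>.
\<close>
lemma band_perms_step_up:
  assumes v: "v \<in> band_perms n" and "v \<noteq> w_square n"
  shows "\<exists>v'\<in>band_perms n. bruhat_step (2 * n) v v'"
proof -
  have p: "v permutes {1..2 * n}" and inj: "inj v" 
    and bnd: "\<And>i. i \<in> {1..2 * n} \<Longrightarrow> v i \<le> i + n \<and> i \<le> v i + n"
    using v permutes_inj by (auto simp: band_perms_def)
  have rng: "v i \<in> {1..2 * n}" if "i \<in> {1..2 * n}" for i
    using that by (simp only: permutes_in_image[OF p])
  define a where "a = (LEAST i. 1 \<le> i \<and> i \<le> n \<and> v i \<noteq> n + i)"
  have "\<exists>i. 1 \<le> i \<and> i \<le> n \<and> v i \<noteq> n + i"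
    using band_perms_eq_w_square[OF v] assms(2) by blast
  then have a: "1 \<le> a" "a \<le> n" "v a \<noteq> n + a" using LeastI_ex[of "\<lambda>i. 1 \<le> i \<and> i \<le> n \<and> v i \<noteq> n + i"] a_def by auto
  have pre: "v i = n + i" if "1 \<le> i" "i < a" for i
    using not_less_Least[of i "\<lambda>i. 1 \<le> i \<and> i \<le> n \<and> v i \<noteq> n + i"] that a a_def by auto
  have va: "v a < n + a" "1 \<le> v a" using bnd[of a] rng[of a] a by auto
  \<comment> \<open>the positions that \<open>b\<close> may have\<close>
  let ?I = "{a + 1..min (2 * n) (n + v a)}"
  obtain b where b: "b \<in> ?I" "v a < v b" "v b \<le> n + a"
  proof (rule ccontr)
    assume "\<not> thesis"
    then have no: "\<And>b. b \<in> ?I \<Longrightarrow> v b \<le> v a \<or> n + a < v b" using that by force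
    \<comment> \<open>the values \<open>n + 1, \<dots>, n + a - 1\<close> are taken by the positions before \<open>a\<close>\<close>
    have ne: "v i \<noteq> v a" "v i \<notin> {n + 1..<n + a}" if "i \<in> ?I" for i
    proof -
      show "v i \<noteq> v a" using that inj by (auto simp: inj_eq)
      show "v i \<notin> {n + 1..<n + a}"
      proof
        assume h: "v i \<in> {n + 1..<n + a}"
        then have "v (v i - n) = v i" using pre[of "v i - n"] by auto
        then have "v i - n = i" using inj by (simp add: inj_eq)
        then show False using h that by auto
      qed
    qed
    have sub: "v ` ?I \<subseteq> {1..min n (v a - 1)} \<union> {n + a + 1..2 * n}"
    proof
      fix y assume "y \<in> v ` ?I"
      then obtain i where i: "i \<in> ?I" "y = v i" by auto
      then have "y \<in> {1..2 * n}" using rng[of i] by auto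
      then show "y \<in> {1..min n (v a - 1)} \<union> {n + a + 1..2 * n}"
        using no[OF i(1)] ne[OF i(1)] va i(2) by auto
    qed
    have "card ?I = card (v ` ?I)" using inj by (simp add: card_image inj_on_subset)
    also have "\<dots> \<le> card ({1..min n (v a - 1)} \<union> {n + a + 1..2 * n})"
      using sub by (intro card_mono) auto
    also have "\<dots> \<le> min n (v a - 1) + (n - a)"
      by (rule order_trans[OF card_Un_le]) simp
    finally have le: "min (2 * n) (n + v a) - a \<le> min n (v a - 1) + (n - a)" by simp
    show False
    proof (cases "v a \<le> n")
      case True then show False using le a va by simp
    next
      case False
      obtain c where c: "v c = n + a" using permutes_surj[OF p] by (metis surjD)
      have "c \<in> {1..2 * n}" using c a by (subst permutes_in_image[OF p, symmetric]) auto
      moreover have "c \<noteq> a" using a c by auto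
      moreover have "\<not> c < a" using pre[of c] c calculation by auto
      ultimately have "c \<in> ?I" using False by auto
      then show False using no[of c] c va by auto
    qed
  qed
  let ?w = "v \<circ> transpose a b"
  have ab: "1 \<le> a" "a < b" "b \<le> 2 * n" using a b by auto
  have "bruhat_step (2 * n) v ?w" unfolding bruhat_step_iff using p ab b by blast
  moreover have "?w \<in> band_perms n"
  proof -
    have "?w i \<le> i + n \<and> i \<le> ?w i + n" if i: "i \<in> {1..2 * n}" for i
    proof -
      consider "i = a" | "i = b" | "i \<noteq> a" "i \<noteq> b" by blast
      then show ?thesis
        by cases (use bnd[OF i] ab b va in \<open>auto simp: transpose_def\<close>)
    qed
    then show ?thesis using permutes_comp_transpose[OF p ab] by (auto simp: band_perms_def)
  qed
  ultimately show ?thesis by blast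
qed

lemma bruhat_interval_w_square: "bruhat_interval (2 * n) id (w_square n) = band_perms n"
proof (intro equalityI subsetI)
  fix v assume "v \<in> bruhat_interval (2 * n) id (w_square n)"
  then have "(bruhat_step (2 * n))\<^sup>*\<^sup>* v (w_square n)"
    by (simp add: bruhat_interval_def bruhat_le_def)
  then show "v \<in> band_perms n"
  proof (induction rule: converse_rtranclp_induct)
    case base show ?case by (rule w_square_band)
  next
    case (step u v) then show ?case using band_perms_down_closed by blast
  qed
next
  fix v assume v: "v \<in> band_perms n"
  then have "(bruhat_step (2 * n))\<^sup>*\<^sup>* v (w_square n)"
  proof (induction "(2 * n) * (2 * n) - perm_length (2 * n) v" arbitrary: v rule: less_induct)
    case less
    show ?case
    proof (cases "v = w_square n")
      case False
      then obtain v' where v': "v' \<in> band_perms n" "bruhat_step (2 * n) v v'"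
        using band_perms_step_up less.prems by blast
      then have "perm_length (2 * n) v < perm_length (2 * n) v'" by (simp add: bruhat_step_def)
      then have "(bruhat_step (2 * n))\<^sup>*\<^sup>* v' (w_square n)"
        using perm_length_le[of "2 * n" v'] v' by (intro less.hyps) auto
      with v'(2) show ?thesis by (rule converse_rtranclp_into_rtranclp)
    qed simp
  qed
  then show "v \<in> bruhat_interval (2 * n) id (w_square n)"
    using v bruhat_le_id w_square_permutes
    by (auto simp: bruhat_interval_def bruhat_le_def band_perms_def)
qed

section \<open>Permutations in the band\<close>

text \<open>
  Permutations of \<open>A\<close> whose graph lies in \<open>D\<close> correspond to placements on \<open>D\<close> of \<open>card A\<close> rooks.
\<close>
lemma bij_betw_graph_rooks:
  assumes fin: "finite A" and D: "D \<subseteq> A \<times> A"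
  shows "bij_betw (\<lambda>v. (\<lambda>i. (i, v i)) ` A)
    {v. v permutes A \<and> (\<forall>i\<in>A. (i, v i) \<in> D)} (rooks_of_size D (card A))"
proof (rule bij_betw_imageI)
  show "inj_on (\<lambda>v. (\<lambda>i. (i, v i)) ` A) {v. v permutes A \<and> (\<forall>i\<in>A. (i, v i) \<in> D)}"
  proof (rule inj_onI, rule ext)
    fix v w i
    assume vw: "v \<in> {v. v permutes A \<and> (\<forall>i\<in>A. (i, v i) \<in> D)}"
      "w \<in> {v. v permutes A \<and> (\<forall>i\<in>A. (i, v i) \<in> D)}"
      and e: "(\<lambda>i. (i, v i)) ` A = (\<lambda>i. (i, w i)) ` A"
    show "v i = w i"
    proof (cases "i \<in> A")
      case True
      then have "(i, v i) \<in> (\<lambda>i. (i, w i)) ` A" using e by blast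
      then show ?thesis by auto
    next
      case False then show ?thesis using vw permutes_not_in[of v A i] permutes_not_in[of w A i] by simp
    qed
  qed
  show "(\<lambda>v. (\<lambda>i. (i, v i)) ` A) ` {v. v permutes A \<and> (\<forall>i\<in>A. (i, v i) \<in> D)}
    = rooks_of_size D (card A)"
  proof (intro equalityI subsetI)
    fix P assume "P \<in> (\<lambda>v. (\<lambda>i. (i, v i)) ` A) ` {v. v permutes A \<and> (\<forall>i\<in>A. (i, v i) \<in> D)}"
    then obtain v where v: "v permutes A" "\<forall>i\<in>A. (i, v i) \<in> D" "P = (\<lambda>i. (i, v i)) ` A" by blast
    have "inj v" using v(1) by (rule permutes_inj)
    then show "P \<in> rooks_of_size D (card A)"
      using v(2) by (auto simp: rooks_of_size_def rooks_def v(3) inj_on_def card_image)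
  next
    fix P assume P: "P \<in> rooks_of_size D (card A)"
    then have inj: "inj_on fst P" "inj_on snd P" and PD: "P \<subseteq> D" and c: "card P = card A"
      by (auto simp: rooks_of_size_def rooks_def)
    have "fst ` P \<subseteq> A" using PD D by auto
    then have fstP: "fst ` P = A"
      using card_image[OF inj(1)] c fin by (intro card_subset_eq) auto
    then have "\<forall>i\<in>A. \<exists>j. (i, j) \<in> P" by force
    then obtain g where g: "\<And>i. i \<in> A \<Longrightarrow> (i, g i) \<in> P" by metis
    define v where "v i = (if i \<in> A then g i else i)" for i
    have vP: "(i, v i) \<in> P" if "i \<in> A" for i using g[OF that] that by (simp add: v_def)
    have "inj_on v A"
    proof (rule inj_onI)
      fix i k assume "i \<in> A" "k \<in> A" "v i = v k"
      then show "i = k" using inj_onD[OF inj(2) _ vP[of i] vP[of k]] by simp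
    qed
    moreover have "v ` A \<subseteq> A" using vP PD D by blast
    ultimately have "bij_betw v A A" using fin by (simp add: bij_betw_def endo_inj_surj)
    then have "v permutes A" by (rule bij_imp_permutes) (simp add: v_def)
    moreover have "P = (\<lambda>i. (i, v i)) ` A"
    proof
      show "(\<lambda>i. (i, v i)) ` A \<subseteq> P" using vP by auto
      show "P \<subseteq> (\<lambda>i. (i, v i)) ` A"
      proof
        fix p assume p: "p \<in> P"
        then have "fst p \<in> A" using fstP by auto
        then have "p = (fst p, v (fst p))" using inj_onD[OF inj(1) _ p vP] by simp
        then show "p \<in> (\<lambda>i. (i, v i)) ` A" using \<open>fst p \<in> A\<close> by auto
      qed
    qed
    ultimately show "P \<in> (\<lambda>v. (\<lambda>i. (i, v i)) ` A) ` {v. v permutes A \<and> (\<forall>i\<in>A. (i, v i) \<in> D)}"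
      using vP PD by blast
  qed
qed

text \<open>
  The cells that the graph of a permutation in the band may use.
\<close>
definition band_board :: "nat \<Rightarrow> (nat \<times> nat) set" where
  "band_board n = {(i, j) \<in> {1..2 * n} \<times> {1..2 * n}. j \<le> i + n \<and> i \<le> j + n}"

lemma card_full_rooks_band:
  "card (rooks_of_size (band_board n) (2 * n)) = (\<Sum>k = 1..n + 1. (fact (k - 1) * Stirling (n + 1) k)\<^sup>2)"
proof -
  let ?L = "{1..n}" and ?R = "{n + 1..2 * n}"
  \<comment> \<open>the quadrants off the diagonal: one is a shifted triangle, the other is rotated by a half turn\<close>
  define T where "T = map_prod id ((+) n) ` triangle n"
  define U where "U = map_prod (\<lambda>i. 2 * n + 1 - i) (\<lambda>j. n + 1 - j) ` triangle n"
  have fin: "finite T" "finite U" by (auto simp: T_def U_def)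
  have T: "(i, j) \<in> T \<longleftrightarrow> i \<in> ?L \<and> j \<in> ?R \<and> j \<le> i + n" for i j
  proof
    assume "i \<in> ?L \<and> j \<in> ?R \<and> j \<le> i + n"
    then have "(i, j - n) \<in> triangle n" "(i, j) = map_prod id ((+) n) (i, j - n)" by (auto simp: triangle_def)
    then show "(i, j) \<in> T" unfolding T_def by (rule rev_image_eqI)
  qed (auto simp: T_def triangle_def)
  have U: "(i, j) \<in> U \<longleftrightarrow> i \<in> ?R \<and> j \<in> ?L \<and> i \<le> j + n" for i j
  proof
    assume "i \<in> ?R \<and> j \<in> ?L \<and> i \<le> j + n"
    then have "(2 * n + 1 - i, n + 1 - j) \<in> triangle n"
      "(i, j) = map_prod (\<lambda>i. 2 * n + 1 - i) (\<lambda>j. n + 1 - j) (2 * n + 1 - i, n + 1 - j)"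
      by (auto simp: triangle_def)
    then show "(i, j) \<in> U" unfolding U_def by (rule rev_image_eqI)
  qed (auto simp: U_def triangle_def)
  let ?S = "?L \<times> ?L \<union> ?R \<times> ?R"
  have board: "band_board n = (T \<union> U) \<union> ?S"
    by (auto simp: band_board_def T U)
  have "card (rooks_of_size (band_board n) (2 * n))
    = (\<Sum>F\<in>rooks (T \<union> U). card {H \<in> rooks (free_cells F ?S). card F + card H = 2 * n})"
    unfolding board using fin by (intro card_rooks_of_size_Un) (auto simp: T U)
  also have "\<dots> = (\<Sum>F\<in>rooks T. \<Sum>G\<in>rooks (free_cells F U).
      card {H \<in> rooks (free_cells (F \<union> G) ?S). card (F \<union> G) + card H = 2 * n})"
    using fin by (intro sum_rooks_Un) (auto simp: T U)
  also have "\<dots> = (\<Sum>F\<in>rooks T. \<Sum>G\<in>rooks U.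
      if card F = card G then (fact (n - card F))\<^sup>2 else 0)"
  proof (rule sum.cong[OF refl])
    fix F assume F: "F \<in> rooks T"
    then have FT: "F \<subseteq> T" by (simp add: rooks_def)
    then have Fs: "fst ` F \<subseteq> ?L" "snd ` F \<subseteq> ?R" using T by auto
    have "fst p \<notin> fst ` F \<and> snd p \<notin> snd ` F" if "p \<in> U" for p
    proof -
      have "fst p \<in> ?R" "snd p \<in> ?L" using that U[of "fst p" "snd p"] by simp_all
      moreover have "?L \<inter> ?R = {}" by auto
      ultimately show ?thesis using Fs by blast
    qed
    then have "free_cells F U = U" by (auto simp only: free_cells_def)
    moreover have "card {H \<in> rooks (free_cells (F \<union> G) ?S). card (F \<union> G) + card H = 2 * n}
        = (if card F = card G then (fact (n - card F))\<^sup>2 else 0)" if G: "G \<in> rooks U" for G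
    proof -
      have GU: "G \<subseteq> U" using G by (simp add: rooks_def)
      then have Gs: "fst ` G \<subseteq> ?R" "snd ` G \<subseteq> ?L" using U by auto
      have finFG: "finite F" "finite G" using F G fin rooks_finite by blast+
      have FG: "card (F \<union> G) = card F + card G"
      proof (rule card_Un_disjoint[OF finFG])
        show "F \<inter> G = {}"
        proof (rule equals0I)
          fix p assume "p \<in> F \<inter> G"
          then have "fst p \<in> ?L" "fst p \<in> ?R" using Fs(1) Gs(1) by blast+
          then show False by simp
        qed
      qed
      have le: "card F \<le> n" "card G \<le> n"
        using card_mono[OF _ Fs(1)] card_mono[OF _ Gs(2)]
        by (simp_all add: rooks_card_fst[OF F] rooks_card_snd[OF G])
      have cards: "card (?L - fst ` F) = n - card F" "card (?L - snd ` G) = n - card G"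
        "card (?R - fst ` G) = n - card G" "card (?R - snd ` F) = n - card F"
        using Fs Gs finFG F G by (simp_all add: card_Diff_subset rooks_card_fst rooks_card_snd)
      have "free_cells (F \<union> G) ?S = (?L - fst ` F) \<times> (?L - snd ` G) \<union> (?R - fst ` G) \<times> (?R - snd ` F)"
        (is "_ = ?B")
      proof -
        have "?L \<inter> ?R = {}" by auto
        then have "?L - fst ` (F \<union> G) = ?L - fst ` F" "?L - snd ` (F \<union> G) = ?L - snd ` G"
          "?R - fst ` (F \<union> G) = ?R - fst ` G" "?R - snd ` (F \<union> G) = ?R - snd ` F"
          using Fs Gs by blast+
        then show ?thesis by (simp only: free_cells_Un free_cells_Times)
      qed
      then have "{H \<in> rooks (free_cells (F \<union> G) ?S). card (F \<union> G) + card H = 2 * n}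
        = rooks_of_size ?B ((n - card F) + (n - card G))"
        using FG le by (auto simp: rooks_of_size_def)
      also have "card \<dots> = (if n - card F = n - card G then (fact (n - card F))\<^sup>2 else 0)"
        by (rule card_rooks_two_blocks) (use cards in auto)
      finally show ?thesis using le by auto
    qed
    ultimately show "(\<Sum>G\<in>rooks (free_cells F U).
        card {H \<in> rooks (free_cells (F \<union> G) ?S). card (F \<union> G) + card H = 2 * n})
      = (\<Sum>G\<in>rooks U. if card F = card G then (fact (n - card F))\<^sup>2 else 0)"
      by simp
  qed
  also have "\<dots> = (\<Sum>F\<in>rooks (triangle n). \<Sum>G\<in>rooks U. if card F = card G then (fact (n - card F))\<^sup>2 else 0)"
    unfolding T_def by (rule sum_rooks_map_prod) auto
  also have "\<dots> = (\<Sum>F\<in>rooks (triangle n). \<Sum>G\<in>rooks (triangle n). if card F = card G then (fact (n - card F))\<^sup>2 else 0)"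
    unfolding U_def by (intro sum.cong refl sum_rooks_map_prod) (auto simp: inj_on_def triangle_def)
  also have "\<dots> = (\<Sum>F\<in>rooks (triangle n). Stirling (n + 1) (n + 1 - card F) * (fact (n - card F))\<^sup>2)"
  proof (rule sum.cong[OF refl])
    fix F
    have "(\<Sum>G\<in>rooks (triangle n). if card F = card G then (fact (n - card F))\<^sup>2 else 0)
      = (\<Sum>G\<in>rooks_of_size (triangle n) (card F). (fact (n - card F))\<^sup>2)"
      by (rule sum.mono_neutral_cong_right) (auto simp: rooks_of_size_def)
    also have "\<dots> = card (rooks_of_size (triangle n) (card F)) * (fact (n - card F))\<^sup>2"
      by simp
    finally show "(\<Sum>G\<in>rooks (triangle n). if card F = card G then (fact (n - card F))\<^sup>2 else 0)
      = Stirling (n + 1) (n + 1 - card F) * (fact (n - card F))\<^sup>2"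
      by (simp only: card_rooks_triangle)
  qed
  also have "\<dots> = (\<Sum>k = 1..n + 1. Stirling (n + 1) k
      * (Stirling (n + 1) (n + 1 - (n + 1 - k)) * (fact (n - (n + 1 - k)))\<^sup>2))"
    by (rule sum_rooks_triangle)
  also have "\<dots> = (\<Sum>k = 1..n + 1. (fact (k - 1) * Stirling (n + 1) k)\<^sup>2)"
  proof (rule sum.cong[OF refl])
    fix k assume "k \<in> {1..n + 1}"
    then have "n + 1 - (n + 1 - k) = k" "n - (n + 1 - k) = k - 1" by auto
    then show "Stirling (n + 1) k * (Stirling (n + 1) (n + 1 - (n + 1 - k)) * (fact (n - (n + 1 - k)))\<^sup>2)
        = (fact (k - 1) * Stirling (n + 1) k)\<^sup>2"
      by (simp add: power2_eq_square del: Stirling.simps)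
  qed
  finally show ?thesis .
qed

lemma x_num_eq_rooks: "x_num n = card (rooks_of_size (band_board n) (2 * n))"
proof -
  have *: "band_perms n = {v. v permutes {1..2 * n} \<and> (\<forall>i\<in>{1..2 * n}. (i, v i) \<in> band_board n)}"
    unfolding band_perms_def
  proof (intro Collect_cong conj_cong refl ball_cong)
    fix v i assume "v permutes {1..2 * n}" "i \<in> {1..2 * n}"
    then show "(v i \<le> i + n \<and> i \<le> v i + n) = ((i, v i) \<in> band_board n)"
      using permutes_in_image[of v "{1..2 * n}" i] by (auto simp: band_board_def)
  qed
  have "card (band_perms n) = card (rooks_of_size (band_board n) (card {1..2 * n}))"
    unfolding * by (rule bij_betw_same_card[OF bij_betw_graph_rooks]) (auto simp: band_board_def)
  then show ?thesis by (simp add: x_num_def bruhat_interval_w_square)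
qed

section \<open>Permutations in the band that lie in the hyperoctahedral group\<close>

text \<open>
  The restriction of \<open>v\<close> to \<open>{1..n}\<close>, split by the size of its values: values \<open>n + j\<close> above \<open>n\<close> give
  the cells \<open>(i, j)\<close> of \<open>high_cells\<close>, and values \<open>n + 1 - j\<close> up to \<open>n\<close> give the cells \<open>(i, j)\<close> of
  \<open>low_cells\<close>. For \<open>v\<close> in \<open>C_perms n\<close> the two values \<open>n + j\<close> and \<open>n + 1 - j\<close> occur at opposite
  positions, so exactly one of them occurs among the first \<open>n\<close>; this is why both belong to column \<open>j\<close>.
  The triangle imposes \<open>j \<le> i\<close>, which is the band condition for \<open>v i = n + j\<close>.
\<close>
definition high_cells :: "nat \<Rightarrow> (nat \<Rightarrow> nat) \<Rightarrow> (nat \<times> nat) set" where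
  "high_cells n v = {(i, j) \<in> triangle n. v i = n + j}"

definition low_cells :: "nat \<Rightarrow> (nat \<Rightarrow> nat) \<Rightarrow> (nat \<times> nat) set" where
  "low_cells n v = {(i, j) \<in> {1..n} \<times> {1..n}. v i + j = n + 1}"

text \<open>
  For \<open>v\<close> in the band and in \<open>C_perms n\<close> the high cells are an arbitrary placement \<open>F\<close> on the triangle,
  and the low cells an arbitrary full placement on the square of the rows and columns that \<open>F\<close> leaves
  free.
\<close>
lemma bij_betw_C_perms:
  "bij_betw (\<lambda>v. (high_cells n v, low_cells n v)) (band_perms n \<inter> C_perms n)
    (SIGMA F:rooks (triangle n).
      rooks_of_size (({1..n} - fst ` F) \<times> ({1..n} - snd ` F)) (n - card F))"
  (is "bij_betw ?f ?V ?S")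
proof (rule bij_betw_imageI)
  show "inj_on ?f ?V"
  proof (rule inj_onI, rule ext)
    fix v w i assume v: "v \<in> ?V" and w: "w \<in> ?V" and e: "?f v = ?f w"
    have left: "v i = w i" if i: "i \<in> {1..n}" for i
    proof (cases "n < v i")
      case True
      then have "(i, v i - n) \<in> high_cells n v"
        using v i by (force simp: high_cells_def triangle_def band_perms_def)
      then have "(i, v i - n) \<in> high_cells n w" using e by simp
      then show ?thesis using True by (simp add: high_cells_def)
    next
      case False
      have vi: "v i \<in> {1..2 * n}"
        using v i by (subst permutes_in_image[of v]) (auto simp: band_perms_def)
      then have "(i, n + 1 - v i) \<in> low_cells n v" using vi i False by (auto simp: low_cells_def)
      then have "(i, n + 1 - v i) \<in> low_cells n w" using e by simp
      then show ?thesis using vi False by (auto simp: low_cells_def)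
    qed
    show "v i = w i"
    proof (cases "i \<in> {1..2 * n}")
      case False
      have "v permutes {1..2 * n}" "w permutes {1..2 * n}" using v w by (auto simp: band_perms_def)
      then show ?thesis using False by (metis permutes_not_in)
    next
      case True
      show ?thesis
      proof (cases "i \<le> n")
        case True then show ?thesis using left \<open>i \<in> {1..2 * n}\<close> by simp
      next
        case False
        then have "2 * n + 1 - i \<in> {1..n}" using True by auto
        then have "v (2 * n + 1 - i) = w (2 * n + 1 - i)" by (rule left)
        moreover have "v i + v (2 * n + 1 - i) = 2 * n + 1" "w i + w (2 * n + 1 - i) = 2 * n + 1"
          using v w True by (auto simp: C_perms_def)
        ultimately show ?thesis by simp
      qed
    qed
  qed
  show "?f ` ?V = ?S"
  proof (intro equalityI subsetI)
    fix s assume "s \<in> ?f ` ?V"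
    then obtain v where v: "v \<in> ?V" and s: "s = ?f v" by blast
    have p: "v permutes {1..2 * n}" and bnd: "\<And>i. i \<in> {1..2 * n} \<Longrightarrow> v i \<le> i + n"
      and sym: "\<And>i. i \<in> {1..2 * n} \<Longrightarrow> v i + v (2 * n + 1 - i) = 2 * n + 1"
      using v by (auto simp: C_perms_def band_perms_def)
    have inj: "inj v" using p by (rule permutes_inj)
    let ?F = "high_cells n v" and ?H = "low_cells n v"
    have F: "?F \<in> rooks (triangle n)"
      using inj by (auto simp: rooks_def high_cells_def inj_on_def)
    have Hinj: "inj_on fst ?H" "inj_on snd ?H"
    proof -
      show "inj_on fst ?H" by (auto simp: low_cells_def inj_on_def)
      show "inj_on snd ?H"
      proof (rule inj_onI, clarsimp)
        fix i j k assume "(i, j) \<in> ?H" "(k, j) \<in> ?H"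
        then have "v i = v k" by (simp add: low_cells_def)
        then show "i = k" using inj by (simp add: inj_eq)
      qed
    qed
    have fsts: "fst ` ?H = {1..n} - fst ` ?F"
    proof (intro equalityI subsetI)
      fix i assume "i \<in> fst ` ?H"
      then show "i \<in> {1..n} - fst ` ?F" by (auto simp: low_cells_def high_cells_def triangle_def)
    next
      fix i assume i: "i \<in> {1..n} - fst ` ?F"
      have "v i \<in> {1..2 * n}" using i by (subst permutes_in_image[OF p]) auto
      moreover have "v i \<le> n"
      proof (rule ccontr)
        assume "\<not> v i \<le> n"
        then have "(i, v i - n) \<in> ?F" using i bnd[of i] by (auto simp: high_cells_def triangle_def)
        then show False using i by force
      qed
      ultimately have "(i, n + 1 - v i) \<in> ?H" using i by (auto simp: low_cells_def)
      then show "i \<in> fst ` ?H" by force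
    qed
    have snds: "j \<notin> snd ` ?F" if "(i, j) \<in> ?H" for i j
    proof
      assume "j \<in> snd ` ?F"
      then obtain i' where i': "(i', j) \<in> ?F" by auto
      then have *: "v i' = n + j" "v i + j = n + 1" "i \<in> {1..n}" "i' \<in> {1..n}"
        using that by (auto simp: low_cells_def high_cells_def triangle_def)
      then have "v i' = v (2 * n + 1 - i)" using sym[of i] by auto
      then have "i' = 2 * n + 1 - i" using inj by (simp add: inj_eq)
      then show False using * by auto
    qed
    have "?H \<subseteq> ({1..n} - fst ` ?F) \<times> ({1..n} - snd ` ?F)"
    proof (rule subrelI)
      fix i j assume h: "(i, j) \<in> ?H"
      then have "i \<in> {1..n} - fst ` ?F" unfolding fsts[symmetric] by (rule image_eqI[rotated]) simp
      moreover have "j \<in> {1..n}" using h by (auto simp: low_cells_def)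
      ultimately show "(i, j) \<in> ({1..n} - fst ` ?F) \<times> ({1..n} - snd ` ?F)" using snds[OF h] by blast
    qed
    moreover have "card ?H = n - card ?F"
    proof -
      have "card ?H = card ({1..n} - fst ` ?F)" using card_image[OF Hinj(1)] fsts by simp
      also have "\<dots> = n - card (fst ` ?F)"
        using rooks_finite[OF finite_triangle F]
        by (subst card_Diff_subset) (auto simp: high_cells_def triangle_def)
      finally show ?thesis using rooks_card_fst[OF F] by simp
    qed
    ultimately show "s \<in> ?S" using F Hinj by (auto simp: s rooks_of_size_def rooks_def)
  next
    fix s assume "s \<in> ?S"
    then obtain F H where s: "s = (F, H)" and F: "F \<in> rooks (triangle n)"
      and H: "H \<in> rooks (({1..n} - fst ` F) \<times> ({1..n} - snd ` F))" and cH: "card H = n - card F"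
      by (auto simp: rooks_of_size_def)
    have Fsub: "F \<subseteq> triangle n" and Finj: "inj_on fst F" "inj_on snd F"
      and Hsub: "H \<subseteq> ({1..n} - fst ` F) \<times> ({1..n} - snd ` F)" and Hinj: "inj_on fst H" "inj_on snd H"
      using F H by (auto simp: rooks_def)
    have "fst ` F \<subseteq> {1..n}" using Fsub by (auto simp: triangle_def)
    then have "card ({1..n} - fst ` F) = n - card F"
      using rooks_card_fst[OF F] by (subst card_Diff_subset) (auto intro: finite_subset)
    moreover have "fst ` H \<subseteq> {1..n} - fst ` F"
      using subsetD[OF Hsub] by (intro image_subsetI) (simp only: mem_Times_iff)
    ultimately have "fst ` H = {1..n} - fst ` F"
      using cH rooks_card_fst[OF H] by (intro card_subset_eq) simp_all
    then have "\<exists>y. (\<exists>j. (i, j) \<in> F \<and> y = n + j) \<or> (\<exists>j. (i, j) \<in> H \<and> y = n + 1 - j)"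
      if "i \<in> {1..n}" for i
    proof -
      have "i \<in> fst ` F \<or> i \<in> fst ` H" using that \<open>fst ` H = {1..n} - fst ` F\<close> by blast
      then have "\<exists>j. (i, j) \<in> F \<or> (i, j) \<in> H" by force
      then show ?thesis by blast
    qed
    then obtain g where g: "\<And>i. i \<in> {1..n} \<Longrightarrow>
        (\<exists>j. (i, j) \<in> F \<and> g i = n + j) \<or> (\<exists>j. (i, j) \<in> H \<and> g i = n + 1 - j)"
      by metis
    have Fc: "1 \<le> i" "i \<le> n" "1 \<le> j" "j \<le> i" if "(i, j) \<in> F" for i j
      using that Fsub by (auto simp: triangle_def)
    have Hc: "1 \<le> i" "i \<le> n" "1 \<le> j" "j \<le> n" if "(i, j) \<in> H" for i j
      using that Hsub by auto
    have FH: "i \<noteq> i'" "j \<noteq> j'" if "(i, j) \<in> F" "(i', j') \<in> H" for i j i' j'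
    proof -
      have "i' \<notin> fst ` F" "j' \<notin> snd ` F" using that(2) Hsub by blast+
      moreover have "i \<in> fst ` F" "j \<in> snd ` F" using that(1) by (auto intro: rev_image_eqI)
      ultimately show "i \<noteq> i'" "j \<noteq> j'" by blast+
    qed
    have Fu: "i = i' \<longleftrightarrow> j = j'" if "(i, j) \<in> F" "(i', j') \<in> F" for i j i' j'
      using inj_onD[OF Finj(1) _ that] inj_onD[OF Finj(2) _ that] by auto
    have Hu: "i = i' \<longleftrightarrow> j = j'" if "(i, j) \<in> H" "(i', j') \<in> H" for i j i' j'
      using inj_onD[OF Hinj(1) _ that] inj_onD[OF Hinj(2) _ that] by auto
    have g_rng: "1 \<le> g i" "g i \<le> i + n" if "i \<in> {1..n}" for i
      using g[OF that] that by (auto dest: Fc Hc)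
    have g_inj: "i = k" if ik: "i \<in> {1..n}" "k \<in> {1..n}" and eq: "g i = g k" for i k
    proof -
      from g[OF ik(1)] show ?thesis
      proof (elim disjE exE conjE)
        fix j assume j: "(i, j) \<in> F" "g i = n + j"
        from g[OF ik(2)] show ?thesis
        proof (elim disjE exE conjE)
          fix j' assume j': "(k, j') \<in> F" "g k = n + j'"
          then show ?thesis using Fu[OF j(1) j'(1)] eq j(2) by simp
        next
          fix j' assume j': "(k, j') \<in> H" "g k = n + 1 - j'"
          then show ?thesis using Fc[OF j(1)] Hc[OF j'(1)] eq j(2) by simp
        qed
      next
        fix j assume j: "(i, j) \<in> H" "g i = n + 1 - j"
        from g[OF ik(2)] show ?thesis
        proof (elim disjE exE conjE)
          fix j' assume j': "(k, j') \<in> F" "g k = n + j'"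
          then show ?thesis using Fc[OF j'(1)] Hc[OF j(1)] eq j(2) by simp
        next
          fix j' assume j': "(k, j') \<in> H" "g k = n + 1 - j'"
          then show ?thesis using Hu[OF j(1) j'(1)] Hc[OF j(1)] Hc[OF j'(1)] eq j(2) by simp
        qed
      qed
    qed
    have g_ne: "g i + g k \<noteq> 2 * n + 1" if ik: "i \<in> {1..n}" "k \<in> {1..n}" for i k
    proof -
      from g[OF ik(1)] show ?thesis
      proof (elim disjE exE conjE)
        fix j assume j: "(i, j) \<in> F" "g i = n + j"
        from g[OF ik(2)] show ?thesis
        proof (elim disjE exE conjE)
          fix j' assume j': "(k, j') \<in> F" "g k = n + j'"
          then show ?thesis using Fc[OF j(1)] Fc[OF j'(1)] j(2) by simp
        next
          fix j' assume j': "(k, j') \<in> H" "g k = n + 1 - j'"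
          then show ?thesis using FH(2)[OF j(1) j'(1)] Hc[OF j'(1)] j(2) by simp
        qed
      next
        fix j assume j: "(i, j) \<in> H" "g i = n + 1 - j"
        from g[OF ik(2)] show ?thesis
        proof (elim disjE exE conjE)
          fix j' assume j': "(k, j') \<in> F" "g k = n + j'"
          then show ?thesis using FH(2)[OF j'(1) j(1)] Hc[OF j(1)] j(2) by simp
        next
          fix j' assume j': "(k, j') \<in> H" "g k = n + 1 - j'"
          then show ?thesis using Hc[OF j(1)] Hc[OF j'(1)] j(2) by simp
        qed
      qed
    qed
    \<comment> \<open>\<open>g\<close> gives the first \<open>n\<close> values; the others are forced by the symmetry of \<open>C_perms n\<close>\<close>
    define v where "v i = (if i \<in> {1..n} then g i
      else if i \<in> {n + 1..2 * n} then 2 * n + 1 - g (2 * n + 1 - i) else i)" for i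
    have v_left: "v i = g i" if "i \<in> {1..n}" for i using that by (simp add: v_def)
    have v_right: "v i = 2 * n + 1 - g (2 * n + 1 - i)" "2 * n + 1 - i \<in> {1..n}"
      if "i \<in> {1..2 * n}" "i \<notin> {1..n}" for i
      using that by (auto simp: v_def)
    have sym: "v i + v (2 * n + 1 - i) = 2 * n + 1" if i: "i \<in> {1..2 * n}" for i
    proof (cases "i \<in> {1..n}")
      case True
      then have "2 * n + 1 - i \<in> {1..2 * n}" "2 * n + 1 - i \<notin> {1..n}" "2 * n + 1 - (2 * n + 1 - i) = i"
        by auto
      then show ?thesis using v_right(1)[of "2 * n + 1 - i"] v_left[OF True] g_rng[OF True] True by auto
    next
      case False
      then show ?thesis using v_right[OF i False] v_left[of "2 * n + 1 - i"] g_rng[of "2 * n + 1 - i"] by auto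
    qed
    have rng: "v i \<in> {1..2 * n}" "v i \<le> i + n" "i \<le> v i + n" if i: "i \<in> {1..2 * n}" for i
      using v_left[of i] v_right[OF i] g_rng[of i] g_rng[of "2 * n + 1 - i"] i
      by (cases "i \<in> {1..n}"; force)+
    have "inj_on v {1..2 * n}"
    proof (rule inj_onI)
      fix i k assume i: "i \<in> {1..2 * n}" and k: "k \<in> {1..2 * n}" and e: "v i = v k"
      show "i = k"
      proof (cases "i \<in> {1..n}")
        case il: True
        show ?thesis
        proof (cases "k \<in> {1..n}")
          case True then show ?thesis using il e v_left g_inj by metis
        next
          case False
          then show ?thesis using v_right[OF k False] v_left[OF il] e
              g_ne[OF il, of "2 * n + 1 - k"] g_rng[of "2 * n + 1 - k"] by auto
        qed
      next
        case ir: False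
        show ?thesis
        proof (cases "k \<in> {1..n}")
          case True
          then show ?thesis using v_right[OF i ir] v_left[OF True] e
              g_ne[OF True, of "2 * n + 1 - i"] g_rng[of "2 * n + 1 - i"] by auto
        next
          case False
          have "v (2 * n + 1 - i) = v (2 * n + 1 - k)"
            using sym[OF i] sym[OF k] e by linarith
          then have "g (2 * n + 1 - i) = g (2 * n + 1 - k)"
            using v_left[OF v_right(2)[OF i ir]] v_left[OF v_right(2)[OF k False]] by simp
          then have "2 * n + 1 - i = 2 * n + 1 - k"
            by (rule g_inj[OF v_right(2)[OF i ir] v_right(2)[OF k False]])
          then show ?thesis using i k by auto
        qed
      qed
    qed
    then have "bij_betw v {1..2 * n} {1..2 * n}"
      using rng(1) by (simp add: bij_betw_def endo_inj_surj image_subset_iff)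
    then have "v permutes {1..2 * n}" by (rule bij_imp_permutes) (auto simp: v_def)
    then have "v \<in> ?V" using rng sym by (auto simp: band_perms_def C_perms_def)
    moreover have "high_cells n v = F"
    proof (intro equalityI subrelI)
      fix i j assume "(i, j) \<in> high_cells n v"
      then have ij: "i \<in> {1..n}" "1 \<le> j" "g i = n + j"
        using v_left by (auto simp: high_cells_def triangle_def)
      from g[OF ij(1)] show "(i, j) \<in> F"
      proof (elim disjE exE conjE)
        fix j' assume "(i, j') \<in> F" "g i = n + j'"
        then show ?thesis using ij by simp
      next
        fix j' assume "(i, j') \<in> H" "g i = n + 1 - j'"
        then show ?thesis using Hc[of i j'] ij by simp
      qed
    next
      fix i j assume ij: "(i, j) \<in> F"
      then have i: "i \<in> {1..n}" using Fc by auto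
      from g[OF i] show "(i, j) \<in> high_cells n v"
      proof (elim disjE exE conjE)
        fix j' assume j': "(i, j') \<in> F" "g i = n + j'"
        then show ?thesis using Fu[OF ij j'(1)] v_left[OF i] ij Fsub by (auto simp: high_cells_def)
      next
        fix j' assume "(i, j') \<in> H"
        then show ?thesis using FH(1)[OF ij] by blast
      qed
    qed
    moreover have "low_cells n v = H"
    proof (intro equalityI subrelI)
      fix i j assume "(i, j) \<in> low_cells n v"
      then have ij: "i \<in> {1..n}" "1 \<le> j" "g i + j = n + 1"
        using v_left by (auto simp: low_cells_def)
      from g[OF ij(1)] show "(i, j) \<in> H"
      proof (elim disjE exE conjE)
        fix j' assume "(i, j') \<in> H" "g i = n + 1 - j'"
        moreover then have "j' = j" using Hc[of i j'] ij by simp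
        ultimately show ?thesis by simp
      next
        fix j' assume "(i, j') \<in> F" "g i = n + j'"
        then show ?thesis using Fc[of i j'] ij by simp
      qed
    next
      fix i j assume ij: "(i, j) \<in> H"
      then have i: "i \<in> {1..n}" using Hc by auto
      from g[OF i] show "(i, j) \<in> low_cells n v"
      proof (elim disjE exE conjE)
        fix j' assume j': "(i, j') \<in> H" "g i = n + 1 - j'"
        then show ?thesis using Hu[OF ij j'(1)] v_left[OF i] Hc[OF ij] by (auto simp: low_cells_def)
      next
        fix j' assume "(i, j') \<in> F"
        then show ?thesis using FH(1)[OF _ ij] by blast
      qed
    qed
    ultimately show "s \<in> ?f ` ?V" using s by blast
  qed
qed

lemma sigma_num_eq: "sigma_num n = (\<Sum>k = 1..n + 1. fact (k - 1) * Stirling (n + 1) k)"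
proof -
  have "sigma_num n = card (SIGMA F:rooks (triangle n).
      rooks_of_size (({1..n} - fst ` F) \<times> ({1..n} - snd ` F)) (n - card F))"
    unfolding sigma_num_def bruhat_interval_w_square
    by (rule bij_betw_same_card[OF bij_betw_C_perms])
  also have "\<dots> = (\<Sum>F\<in>rooks (triangle n).
      card (rooks_of_size (({1..n} - fst ` F) \<times> ({1..n} - snd ` F)) (n - card F)))"
    by simp
  also have "\<dots> = (\<Sum>F\<in>rooks (triangle n). fact (n - card F))"
  proof (rule sum.cong[OF refl], rule card_rooks_square)
    fix F assume F: "F \<in> rooks (triangle n)"
    then have "fst ` F \<subseteq> {1..n}" "snd ` F \<subseteq> {1..n}" by (fastforce simp: rooks_def triangle_def)+
    then show "card ({1..n} - fst ` F) = n - card F" "card ({1..n} - snd ` F) = n - card F"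
      using rooks_card_fst[OF F] rooks_card_snd[OF F]
      by (subst card_Diff_subset; auto intro: finite_subset)+
  qed auto
  also have "\<dots> = (\<Sum>k = 1..n + 1. Stirling (n + 1) k * fact (n - (n + 1 - k)))"
    by (rule sum_rooks_triangle)
  also have "\<dots> = (\<Sum>k = 1..n + 1. fact (k - 1) * Stirling (n + 1) k)"
  proof (rule sum.cong[OF refl])
    fix k assume "k \<in> {1..n + 1}"
    then have "n - (n + 1 - k) = k - 1" by auto
    then show "Stirling (n + 1) k * fact (n - (n + 1 - k)) = fact (k - 1) * Stirling (n + 1) k"
      by (simp del: Stirling.simps)
  qed
  finally show ?thesis .
qed

theorem proposition5p5:
  fixes n :: nat
  assumes "n \<ge> 1"
  shows "x_num n = (\<Sum>k = 1..n + 1. (fact (k - 1) * Stirling (n + 1) k)\<^sup>2)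
    \<and> sigma_num n = (\<Sum>k = 1..n + 1. fact (k - 1) * Stirling (n + 1) k)"
proof
  show "x_num n = (\<Sum>k = 1..n + 1. (fact (k - 1) * Stirling (n + 1) k)\<^sup>2)"
    by (rule trans[OF x_num_eq_rooks card_full_rooks_band])
  show "sigma_num n = (\<Sum>k = 1..n + 1. fact (k - 1) * Stirling (n + 1) k)"
    by (rule sigma_num_eq)
qed

end
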